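(* The sequence $$\varkappa(n)=\sup_{u\ge1}\inf_{v>0}n^{\frac1{u+v}}\frac{\psi(u+v)}{\psi(u)}$$ is a majorizing characteristic of the space $\mathbf F_\psi(\Omega)$, i.e. it is a non-decreasing numerical sequence and for any $\xi_1,\dots,\xi_n\in\mathbf F_\psi(\Omega)$ $$\Big\|\max_{1\le i\le n}|\xi_i|\Big\|_\psi\le\varkappa(n)\max_{1\le i\le n}\|\xi_i\|_\psi.$$
   Context: $\psi(u)>0$, $u\ge1$, is a monotonically increasing continuous function with $\psi(u)\to\infty$ as $u\to\infty$. $\mathbf F_\psi(\Omega)$ is the Banach space of random variables $\xi$ with norm $\|\xi\|_\psi=\sup_{u\ge1}\frac{(E|\xi|^u)^{1/u}}{\psi(u)}<\infty$. *)

theory Defs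
  imports "HOL-Probability.Probability"
begin

text \<open>
  Random variables are functions rather than almost-sure equivalence classes, so
  \<open>F_norm\<close> is a seminorm on \<open>F_space\<close>.  It is real-valued, and meaningful only on
  \<open>F_space\<close>, whose two conditions say that every absolute moment \<open>E |\<xi>|\<^sup>u\<close>, \<open>u \<ge> 1\<close>,
  is finite and that the supremum defining the norm is finite.
\<close>

definition F_norm :: "'a measure \<Rightarrow> (real \<Rightarrow> real) \<Rightarrow> ('a \<Rightarrow> real) \<Rightarrow> real" where
  "F_norm M \<psi> \<xi> =
     (SUP u\<in>{1..}. (\<integral>\<omega>. \<bar>\<xi> \<omega>\<bar> powr u \<partial>M) powr (1 / u) / \<psi> u)"

definition F_space :: "'a measure \<Rightarrow> (real \<Rightarrow> real) \<Rightarrow> ('a \<Rightarrow> real) set" where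
  "F_space M \<psi> = {\<xi> \<in> borel_measurable M.
     (\<forall>u\<ge>1. integrable M (\<lambda>\<omega>. \<bar>\<xi> \<omega>\<bar> powr u)) \<and>
     bdd_above ((\<lambda>u. (\<integral>\<omega>. \<bar>\<xi> \<omega>\<bar> powr u \<partial>M) powr (1 / u) / \<psi> u) ` {1..})}"

text \<open>
  Sequences are indexed by \<open>n \<ge> 1\<close>; the value at 0 is irrelevant.  As \<open>N\<close> is
  real-valued and meaningful only on \<open>K\<close>, finiteness of the left-hand norm, implicit
  in the inequality, is stated as membership of the maximum in \<open>K\<close>.
\<close>

definition majorizing_characteristic ::
    "('a \<Rightarrow> real) set \<Rightarrow> (('a \<Rightarrow> real) \<Rightarrow> real) \<Rightarrow> (nat \<Rightarrow> real) \<Rightarrow> bool" where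
  "majorizing_characteristic K N \<kappa> \<longleftrightarrow>
     mono_on {1..} \<kappa> \<and>
     (\<forall>n\<ge>1. \<forall>\<xi>. (\<forall>i\<in>{1..n}. \<xi> i \<in> K) \<longrightarrow>
        (\<lambda>\<omega>. MAX i\<in>{1..n}. \<bar>\<xi> i \<omega>\<bar>) \<in> K \<and>
        N (\<lambda>\<omega>. MAX i\<in>{1..n}. \<bar>\<xi> i \<omega>\<bar>) \<le> \<kappa> n * (MAX i\<in>{1..n}. N (\<xi> i)))"

text \<open>
  Extended-real valued, so that the supremum and infimum are the true ones without
  any boundedness requirement.
\<close>

definition F_kappa :: "(real \<Rightarrow> real) \<Rightarrow> nat \<Rightarrow> ereal" where
  "F_kappa \<psi> n =
     (SUP u\<in>{1..}. INF v\<in>{0<..}. ereal (real n powr (1 / (u + v)) * (\<psi> (u + v) / \<psi> u)))"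

end

theory Submission
  imports Defs
begin

text \<open>
  Write \<open>|\<xi>|\<^sub>u\<close> for \<open>(E |\<xi>|\<^sup>u)\<^sup>1\<^sup>/\<^sup>u\<close>, so that \<open>|\<xi>|\<^sub>u \<le> \<psi>(u) \<parallel>\<xi>\<parallel>\<^sub>\<psi>\<close>, and let
  \<open>X = max |\<xi>\<^sub>i|\<close> and \<open>B = max \<parallel>\<xi>\<^sub>i\<parallel>\<^sub>\<psi>\<close> over \<open>n\<close> variables.  The pointwise bound
  \<open>X\<^sup>w \<le> \<Sum> |\<xi>\<^sub>i|\<^sup>w\<close> gives \<open>|X|\<^sub>w \<le> n\<^sup>1\<^sup>/\<^sup>w \<psi>(w) B\<close>.  Taken at \<open>w = u\<close> this costs the factor
  \<open>n\<^sup>1\<^sup>/\<^sup>u\<close>.  On a probability space, however, \<open>|X|\<^sub>u \<le> |X|\<^sub>w\<close> for every \<open>w > u\<close>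
  (\<open>moment_norm_mono\<close>), so passing to \<open>w = u + v\<close> weakens the power of \<open>n\<close> at the price of
  the ratio \<open>\<psi>(u + v) / \<psi>(u)\<close>:
  \<open>|X|\<^sub>u / \<psi>(u) \<le> n\<^sup>1\<^sup>/\<^sup>(\<^sup>u\<^sup>+\<^sup>v\<^sup>) (\<psi>(u + v) / \<psi>(u)) B\<close>.
  The best \<open>v\<close> for each \<open>u\<close>, and then the worst \<open>u\<close>, produce the characteristic \<open>\<kappa>(n)\<close>.

  For \<open>n \<ge> 1\<close> the characteristic lies between \<open>1\<close> and \<open>n\<close>: every factor is at least \<open>1\<close>
  because \<open>\<psi>\<close> increases, and letting \<open>v\<close> decrease to \<open>0\<close> shows, by continuity of \<open>\<psi>\<close>, that
  the infimum is at most \<open>n\<^sup>1\<^sup>/\<^sup>u \<le> n\<close>.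
\<close>

abbreviation moment_norm :: "'a measure \<Rightarrow> real \<Rightarrow> ('a \<Rightarrow> real) \<Rightarrow> real" where
  "moment_norm M u \<xi> \<equiv> (\<integral>\<omega>. \<bar>\<xi> \<omega>\<bar> powr u \<partial>M) powr (1 / u)"

section \<open>Moments of a maximum\<close>

text \<open>
  Lyapunov's inequality.  Weighted AM-GM with weights \<open>u/w\<close> and \<open>1 - u/w\<close>, applied to
  \<open>|\<xi>|\<^sup>w\<close> and its mean \<open>C\<close>, gives \<open>|\<xi>|\<^sup>u C\<^sup>1\<^sup>-\<^sup>u\<^sup>/\<^sup>w \<le> (u/w) |\<xi>|\<^sup>w + (1 - u/w) C\<close>; the right-hand
  side has mean \<open>C\<close> because the total mass is 1.
\<close>

lemma (in prob_space) moment_norm_mono: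
  fixes \<xi> :: "'a \<Rightarrow> real"
  assumes uw: "0 < u" "u < w"
    and meas [measurable]: "\<xi> \<in> borel_measurable M"
    and intu: "integrable M (\<lambda>\<omega>. \<bar>\<xi> \<omega>\<bar> powr u)"
    and intw: "integrable M (\<lambda>\<omega>. \<bar>\<xi> \<omega>\<bar> powr w)"
  shows "moment_norm M u \<xi> \<le> moment_norm M w \<xi>"
proof -
  define C where "C = (\<integral>\<omega>. \<bar>\<xi> \<omega>\<bar> powr w \<partial>M)"
  define \<alpha> where "\<alpha> = u / w"
  have \<alpha>: "0 < \<alpha>" "\<alpha> < 1" using uw by (auto simp: \<alpha>_def)
  have C0: "C \<ge> 0" unfolding C_def by simp
  have mean: "(\<integral>\<omega>. \<bar>\<xi> \<omega>\<bar> powr u \<partial>M) \<le> C powr \<alpha>"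
  proof (cases "C = 0")
    case True
    then have "AE \<omega> in M. \<bar>\<xi> \<omega>\<bar> powr w = 0"
      using integral_nonneg_eq_0_iff_AE[OF intw] by (simp add: C_def)
    then have "AE \<omega> in M. \<bar>\<xi> \<omega>\<bar> powr u = 0" by eventually_elim simp
    then have "(\<integral>\<omega>. \<bar>\<xi> \<omega>\<bar> powr u \<partial>M) = 0" by (rule integral_eq_zero_AE)
    then show ?thesis by simp
  next
    case False
    then have C: "C > 0" using C0 by simp
    have "\<bar>\<xi> \<omega>\<bar> powr u * C powr (1 - \<alpha>) \<le> \<alpha> * \<bar>\<xi> \<omega>\<bar> powr w + (1 - \<alpha>) * C" for \<omega>
    proof (cases "\<xi> \<omega> = 0")
      case True
      then show ?thesis using \<alpha> C by simp
    next
      case False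
      have "(\<bar>\<xi> \<omega>\<bar> powr w) powr \<alpha> = \<bar>\<xi> \<omega>\<bar> powr u"
        using uw by (simp add: powr_powr \<alpha>_def)
      then show ?thesis
        using Youngs_inequality_0[of \<alpha> "1 - \<alpha>" "\<bar>\<xi> \<omega>\<bar> powr w" C] \<alpha> C False by simp
    qed
    then have "(\<integral>\<omega>. \<bar>\<xi> \<omega>\<bar> powr u * C powr (1 - \<alpha>) \<partial>M)
        \<le> (\<integral>\<omega>. \<alpha> * \<bar>\<xi> \<omega>\<bar> powr w + (1 - \<alpha>) * C \<partial>M)"
      using intu intw by (intro integral_mono) auto
    also have "\<dots> = \<alpha> * C + (1 - \<alpha>) * C"
      using intw by (simp add: C_def prob_space)
    also have "\<dots> = C powr \<alpha> * C powr (1 - \<alpha>)"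
      using C by (simp flip: powr_add add: algebra_simps)
    finally show ?thesis using C by simp
  qed
  have "moment_norm M u \<xi> \<le> (C powr \<alpha>) powr (1 / u)"
    using mean uw by (intro powr_mono2) auto
  also have "\<dots> = C powr (1 / w)"
    using uw by (simp add: powr_powr \<alpha>_def)
  finally show ?thesis by (simp add: C_def)
qed

lemma Max_abs_powr_le_sum:
  fixes f :: "'i \<Rightarrow> real"
  assumes "finite I" "I \<noteq> {}"
  shows "\<bar>MAX i\<in>I. \<bar>f i\<bar>\<bar> powr u \<le> (\<Sum>i\<in>I. \<bar>f i\<bar> powr u)"
proof -
  have "(MAX i\<in>I. \<bar>f i\<bar>) \<in> (\<lambda>i. \<bar>f i\<bar>) ` I" using assms by (intro Max_in) auto
  then obtain j where j: "j \<in> I" "(MAX i\<in>I. \<bar>f i\<bar>) = \<bar>f j\<bar>" by auto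
  then show ?thesis using member_le_sum[of j I "\<lambda>i. \<bar>f i\<bar> powr u"] assms by simp
qed

lemma integrable_Max_abs_powr:
  fixes \<xi> :: "'i \<Rightarrow> 'a \<Rightarrow> real"
  assumes I: "finite I" "I \<noteq> {}"
    and meas: "\<And>i. i \<in> I \<Longrightarrow> \<xi> i \<in> borel_measurable M"
    and int: "\<And>i. i \<in> I \<Longrightarrow> integrable M (\<lambda>\<omega>. \<bar>\<xi> i \<omega>\<bar> powr u)"
  shows "integrable M (\<lambda>\<omega>. \<bar>MAX i\<in>I. \<bar>\<xi> i \<omega>\<bar>\<bar> powr u)"
proof (rule Bochner_Integration.integrable_bound)
  show "integrable M (\<lambda>\<omega>. \<Sum>i\<in>I. \<bar>\<xi> i \<omega>\<bar> powr u)"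
    using int by (rule Bochner_Integration.integrable_sum)
  have [measurable]: "(\<lambda>\<omega>. MAX i\<in>I. \<bar>\<xi> i \<omega>\<bar>) \<in> borel_measurable M"
    using I meas by (intro borel_measurable_Max) auto
  show "(\<lambda>\<omega>. \<bar>MAX i\<in>I. \<bar>\<xi> i \<omega>\<bar>\<bar> powr u) \<in> borel_measurable M" by measurable
  show "AE \<omega> in M. norm (\<bar>MAX i\<in>I. \<bar>\<xi> i \<omega>\<bar>\<bar> powr u) \<le> norm (\<Sum>i\<in>I. \<bar>\<xi> i \<omega>\<bar> powr u)"
    using Max_abs_powr_le_sum[OF I] by (intro AE_I2) (simp add: abs_of_nonneg sum_nonneg)
qed

lemma moment_norm_Max_le:
  fixes \<xi> :: "'i \<Rightarrow> 'a \<Rightarrow> real"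
  assumes w: "0 < w" and I: "finite I" "I \<noteq> {}"
    and meas: "\<And>i. i \<in> I \<Longrightarrow> \<xi> i \<in> borel_measurable M"
    and int: "\<And>i. i \<in> I \<Longrightarrow> integrable M (\<lambda>\<omega>. \<bar>\<xi> i \<omega>\<bar> powr w)"
    and le: "\<And>i. i \<in> I \<Longrightarrow> moment_norm M w (\<xi> i) \<le> D"
  shows "moment_norm M w (\<lambda>\<omega>. MAX i\<in>I. \<bar>\<xi> i \<omega>\<bar>) \<le> real (card I) powr (1 / w) * D"
proof -
  obtain j where "j \<in> I" using I by auto
  with le[of j] have D: "0 \<le> D" by (meson order_trans powr_ge_zero)
  have single: "(\<integral>\<omega>. \<bar>\<xi> i \<omega>\<bar> powr w \<partial>M) \<le> D powr w" if "i \<in> I" for i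
  proof -
    have "(\<integral>\<omega>. \<bar>\<xi> i \<omega>\<bar> powr w \<partial>M) = moment_norm M w (\<xi> i) powr w"
      using w by (simp add: powr_powr)
    also have "\<dots> \<le> D powr w" using le[OF that] w by (intro powr_mono2) auto
    finally show ?thesis .
  qed
  have "(\<integral>\<omega>. \<bar>MAX i\<in>I. \<bar>\<xi> i \<omega>\<bar>\<bar> powr w \<partial>M) \<le> (\<integral>\<omega>. (\<Sum>i\<in>I. \<bar>\<xi> i \<omega>\<bar> powr w) \<partial>M)"
    using integrable_Max_abs_powr[OF I meas int] int Max_abs_powr_le_sum[OF I]
    by (intro integral_mono) auto
  also have "\<dots> = (\<Sum>i\<in>I. \<integral>\<omega>. \<bar>\<xi> i \<omega>\<bar> powr w \<partial>M)"
    using int by (rule Bochner_Integration.integral_sum)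
  also have "\<dots> \<le> (\<Sum>i\<in>I. D powr w)" using single by (rule sum_mono)
  also have "\<dots> = real (card I) * D powr w" by simp
  finally have "moment_norm M w (\<lambda>\<omega>. MAX i\<in>I. \<bar>\<xi> i \<omega>\<bar>) \<le> (real (card I) * D powr w) powr (1 / w)"
    using w by (intro powr_mono2) auto
  also have "\<dots> = real (card I) powr (1 / w) * D"
    using w D by (simp add: powr_mult powr_powr)
  finally show ?thesis .
qed

section \<open>The characteristic as an extended real\<close>

lemma F_kappa_mono:
  assumes pos: "\<And>u. u \<ge> 1 \<Longrightarrow> \<psi> u > 0" and "m \<le> n"
  shows "F_kappa \<psi> m \<le> F_kappa \<psi> n"
  unfolding F_kappa_def
proof (intro SUP_subset_mono INF_superset_mono order_refl)
  fix u v :: real assume "u \<in> {1..}" "v \<in> {0<..}"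
  then show "ereal (real m powr (1 / (u + v)) * (\<psi> (u + v) / \<psi> u))
      \<le> ereal (real n powr (1 / (u + v)) * (\<psi> (u + v) / \<psi> u))"
    using \<open>m \<le> n\<close> pos[of u] pos[of "u + v"]
    by (simp only: ereal_less_eq) (intro mult_right_mono powr_mono2; auto)
qed

lemma F_kappa_ge_1:
  assumes pos: "\<And>u. u \<ge> 1 \<Longrightarrow> \<psi> u > 0" and mono: "mono_on {1..} \<psi>" and n: "n \<ge> 1"
  shows "1 \<le> F_kappa \<psi> n"
proof -
  have "1 \<le> real n powr (1 / (1 + v)) * (\<psi> (1 + v) / \<psi> 1)" if "v > 0" for v
  proof -
    have "1 \<le> real n powr (1 / (1 + v))" using n that by (intro ge_one_powr_ge_zero) auto
    moreover have "1 \<le> \<psi> (1 + v) / \<psi> 1"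
      using mono_onD[OF mono, of 1 "1 + v"] pos[of 1] that by simp
    ultimately show ?thesis using mult_mono[of 1 _ 1] by force
  qed
  then have "1 \<le> (INF v\<in>{0<..}. ereal (real n powr (1 / (1 + v)) * (\<psi> (1 + v) / \<psi> 1)))"
    by (intro INF_greatest) auto
  also have "\<dots> \<le> F_kappa \<psi> n"
    unfolding F_kappa_def by (rule SUP_upper2[of 1]) auto
  finally show ?thesis .
qed

lemma F_kappa_le:
  assumes pos: "\<And>u. u \<ge> 1 \<Longrightarrow> \<psi> u > 0" and cont: "continuous_on {1..} \<psi>" and n: "n \<ge> 1"
  shows "F_kappa \<psi> n \<le> ereal (real n)"
  unfolding F_kappa_def
proof (rule SUP_least)
  fix u :: real assume "u \<in> {1..}"
  then have u: "u \<ge> 1" by simp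
  let ?f = "\<lambda>v. real n powr (1 / (u + v)) * (\<psi> (u + v) / \<psi> u)"
  have lim: "(?f \<longlongrightarrow> real n powr (1 / u)) (at_right 0)"
  proof -
    have "continuous_on {0..} (\<lambda>v. \<psi> (u + v))"
      using u by (intro continuous_on_compose2[OF cont] continuous_intros) auto
    then have "continuous_on {0..} ?f"
      using u n by (intro continuous_intros) (auto simp: pos[OF u, THEN less_imp_neq, symmetric])
    then have "(?f \<longlongrightarrow> ?f 0) (at 0 within {0..})"
      unfolding continuous_on_def by (rule bspec) simp
    then have "(?f \<longlongrightarrow> ?f 0) (at_right 0)"
      by (rule tendsto_within_subset) auto
    then show ?thesis using pos[OF u] by simp
  qed
  have "(INF v\<in>{0<..}. ereal (?f v)) \<le> ereal (real n powr (1 / u))"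
  proof (rule tendsto_lowerbound)
    show "((\<lambda>v. ereal (?f v)) \<longlongrightarrow> ereal (real n powr (1 / u))) (at_right 0)"
      using lim by (rule tendsto_ereal)
    show "\<forall>\<^sub>F v in at_right 0. (INF v\<in>{0<..}. ereal (?f v)) \<le> ereal (?f v)"
      using eventually_at_right_less[of 0] by eventually_elim (rule INF_lower, simp)
  qed simp
  also have "real n powr (1 / u) \<le> real n powr 1"
    using u n by (intro powr_mono) auto
  then have "ereal (real n powr (1 / u)) \<le> ereal (real n)" using n by simp
  finally show "(INF v\<in>{0<..}. ereal (?f v)) \<le> ereal (real n)" .
qed

section \<open>The majorizing property\<close>

lemma moment_norm_le_F_norm:
  assumes "\<xi> \<in> F_space M \<psi>" "u \<ge> 1" "\<psi> u > 0"
  shows "moment_norm M u \<xi> \<le> \<psi> u * F_norm M \<psi> \<xi>"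
proof -
  have "moment_norm M u \<xi> / \<psi> u \<le> F_norm M \<psi> \<xi>"
    unfolding F_norm_def using assms by (intro cSUP_upper) (auto simp: F_space_def)
  then show ?thesis using assms by (simp add: field_simps)
qed

text \<open>
  If \<open>x\<close> is bounded for every \<open>v\<close>, it is bounded with the infimum over \<open>v\<close> as constant.
  The parameter \<open>v\<close> may be chosen depending on \<open>u\<close>, and the supremum over \<open>u\<close> makes the
  bound uniform: this accounts for the order of \<open>sup\<close> and \<open>inf\<close> in the characteristic.
\<close>

lemma le_F_kappa_mult:
  assumes \<kappa>: "F_kappa \<psi> n = ereal k" and u: "u \<ge> 1" and B: "B \<ge> 0"
    and le: "\<And>v. v > 0 \<Longrightarrow> x \<le> real n powr (1 / (u + v)) * (\<psi> (u + v) / \<psi> u) * B"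
  shows "x \<le> k * B"
proof (cases "B = 0")
  case True
  then show ?thesis using le[of 1] by simp
next
  case False
  with B have B: "B > 0" by simp
  have "ereal (x / B) \<le> (INF v\<in>{0<..}. ereal (real n powr (1 / (u + v)) * (\<psi> (u + v) / \<psi> u)))"
  proof (rule INF_greatest)
    fix v :: real assume "v \<in> {0<..}"
    then show "ereal (x / B) \<le> ereal (real n powr (1 / (u + v)) * (\<psi> (u + v) / \<psi> u))"
      using le[of v] B by (simp only: ereal_less_eq pos_divide_le_eq greaterThan_iff)
  qed
  also have "\<dots> \<le> F_kappa \<psi> n"
    unfolding F_kappa_def using u by (intro SUP_upper) simp
  finally have "x / B \<le> k" by (simp add: \<kappa>)
  then show ?thesis using B by (simp add: pos_divide_le_eq)
qed

theorem theorem2p6: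
  fixes M :: "'a measure" and \<psi> :: "real \<Rightarrow> real"
  assumes "prob_space M"
    and "\<And>u. u \<ge> 1 \<Longrightarrow> \<psi> u > 0"
    and "mono_on {1..} \<psi>"
    and "continuous_on {1..} \<psi>"
    and "filterlim \<psi> at_top at_top"
  shows "(\<forall>n\<ge>1. \<bar>F_kappa \<psi> n\<bar> \<noteq> \<infinity>) \<and>
    majorizing_characteristic (F_space M \<psi>) (F_norm M \<psi>) (\<lambda>n. real_of_ereal (F_kappa \<psi> n))"
proof -
  interpret prob_space M by fact
  note pos = assms(2)
  have fin: "\<bar>F_kappa \<psi> n\<bar> \<noteq> \<infinity>" if "n \<ge> 1" for n
    using F_kappa_ge_1[OF pos assms(3) that] F_kappa_le[OF pos assms(4) that]
    by (cases "F_kappa \<psi> n") auto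
  have mono: "mono_on {1..} (\<lambda>n. real_of_ereal (F_kappa \<psi> n))"
  proof (rule mono_onI)
    fix m n :: nat assume "m \<in> {1..}" "n \<in> {1..}" and mn: "m \<le> n"
    then have "\<bar>F_kappa \<psi> m\<bar> \<noteq> \<infinity>" "\<bar>F_kappa \<psi> n\<bar> \<noteq> \<infinity>" by (auto intro!: fin)
    with F_kappa_mono[of \<psi>, OF pos mn] show "real_of_ereal (F_kappa \<psi> m) \<le> real_of_ereal (F_kappa \<psi> n)"
      by (cases "F_kappa \<psi> m"; cases "F_kappa \<psi> n"; simp)
  qed
  have major: "X \<in> F_space M \<psi> \<and>
      F_norm M \<psi> X \<le> real_of_ereal (F_kappa \<psi> n) * (MAX i\<in>{1..n}. F_norm M \<psi> (\<xi> i))"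
    if n: "n \<ge> 1" and \<xi>: "\<forall>i\<in>{1..n}. \<xi> i \<in> F_space M \<psi>"
      and X: "X = (\<lambda>\<omega>. MAX i\<in>{1..n}. \<bar>\<xi> i \<omega>\<bar>)" for n X and \<xi> :: "nat \<Rightarrow> 'a \<Rightarrow> real"
  proof -
    define k where "k = real_of_ereal (F_kappa \<psi> n)"
    have k: "F_kappa \<psi> n = ereal k" using fin[OF n] by (simp add: k_def ereal_real')
    define B where "B = (MAX i\<in>{1..n}. F_norm M \<psi> (\<xi> i))"
    have ne: "{1..n} \<noteq> {}" using n by simp
    have meas: "\<xi> i \<in> borel_measurable M" if "i \<in> {1..n}" for i
      using \<xi> that by (auto simp: F_space_def)
    have int: "integrable M (\<lambda>\<omega>. \<bar>\<xi> i \<omega>\<bar> powr u)" if "u \<ge> 1" "i \<in> {1..n}" for u i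
      using \<xi> that by (auto simp: F_space_def)
    have le_B: "moment_norm M u (\<xi> i) \<le> \<psi> u * B" if "u \<ge> 1" "i \<in> {1..n}" for u i
    proof -
      have "F_norm M \<psi> (\<xi> i) \<le> B" using that unfolding B_def by (intro Max_ge) auto
      have "moment_norm M u (\<xi> i) \<le> \<psi> u * F_norm M \<psi> (\<xi> i)"
        using \<xi> that pos[OF that(1)] by (intro moment_norm_le_F_norm) auto
      also have "\<dots> \<le> \<psi> u * B"
        using \<open>F_norm M \<psi> (\<xi> i) \<le> B\<close> pos[OF that(1)] by simp
      finally show ?thesis .
    qed
    have B: "B \<ge> 0"
    proof -
      have "0 \<le> moment_norm M 1 (\<xi> 1)" by (rule powr_ge_zero)
      also have "\<dots> \<le> \<psi> 1 * B" using n by (intro le_B) auto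
      finally have "0 \<le> \<psi> 1 * B" .
      then show ?thesis using pos[of 1] by (simp add: zero_le_mult_iff)
    qed
    have X_meas: "X \<in> borel_measurable M"
      unfolding X using meas by (intro borel_measurable_Max) auto
    have X_int: "integrable M (\<lambda>\<omega>. \<bar>X \<omega>\<bar> powr u)" if "u \<ge> 1" for u
      unfolding X using meas int[OF that] ne by (intro integrable_Max_abs_powr) auto
    have bound: "moment_norm M u X / \<psi> u \<le> k * B" if u: "u \<ge> 1" for u
    proof (rule le_F_kappa_mult[OF k u B])
      fix v :: real assume v: "v > 0"
      have "moment_norm M u X \<le> moment_norm M (u + v) X"
        using u v by (intro moment_norm_mono X_meas X_int) auto
      also have "\<dots> \<le> real (card {1..n}) powr (1 / (u + v)) * (\<psi> (u + v) * B)"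
        unfolding X using u v ne by (intro moment_norm_Max_le meas int le_B) auto
      finally show "moment_norm M u X / \<psi> u \<le> real n powr (1 / (u + v)) * (\<psi> (u + v) / \<psi> u) * B"
        using pos[OF u] by (simp add: field_simps)
    qed
    have "X \<in> F_space M \<psi>"
      using X_meas X_int bound by (auto simp: F_space_def intro!: bdd_aboveI2)
    moreover have "F_norm M \<psi> X \<le> k * B"
      unfolding F_norm_def using bound by (intro cSUP_least) auto
    ultimately show ?thesis by (simp add: k_def B_def)
  qed
  show ?thesis
    unfolding majorizing_characteristic_def using fin mono major by blast
qed

end
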